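(* For $p>0$ let $$\omega(p)=\left[\frac pe\Big(\Gamma(p)-\int_0^1t^{p-1}e^t\,dt\Big)+1\right]^{1/p}.$$ Let $\varphi_0(t)=\log(1/t)$, $t\in(0,1)$. Then, with respect to $A_\infty((0,1))$, $$\varepsilon_{\varphi_0}=1,\qquad\varepsilon_{-\varphi_0}=\infty.$$ If $p\ge1$, then $$\|\varphi_0\|_{\mathrm{BMO}^p((0,1))}=\omega(p).$$ Consequently, for $p\ge1$, $$\varepsilon_0(p)\le\omega(p)\qquad\text{and}\qquad C(\varepsilon,p)\ge\frac{e^{-\varepsilon/\omega(p)}}{1-\varepsilon/\omega(p)},\quad0\le\varepsilon<\omega(p),$$ where $\varepsilon_0(p)$ and $C(\varepsilon,p)$ are the John--Nirenberg constant of $\mathrm{BMO}^p((0,1))$ and the best constant in the integral John--Nirenberg inequality defined in the context.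
   Context: For an interval $J$, $\langle\varphi\rangle_J=\frac1{|J|}\int_J\varphi$. For an interval $Q$ and $p>0$, $\|\varphi\|_{\mathrm{BMO}^p(Q)}=\sup_{J\subset Q}\langle|\varphi-\langle\varphi\rangle_J|^p\rangle_J^{1/p}$, the supremum being over all subintervals $J$ of $Q$; $\mathrm{BMO}(Q)$ is the set of locally integrable $\varphi$ for which this is finite (the set is the same for all $p>0$). An a.e. positive function $w$ is in $A_\infty(Q)$ if $w$ and $\log w$ are locally integrable and $[w]_{A_\infty(Q)}:=\sup_{J\subset Q}\langle w\rangle_Je^{-\langle\log w\rangle_J}<\infty$ (supremum over subintervals $J$ of $Q$). For $\varphi\in\mathrm{BMO}(Q)$, $\varepsilon_\varphi=\sup\{\varepsilon>0:\ e^{\varepsilon\varphi}\in A_\infty(Q)\}\in(0,\infty]$. For $p>0$ and $\varepsilon\ge0$ let $C(\varepsilon,p)\in[1,\infty]$ be the smallest constant such that $\langle e^\varphi\rangle_J\le C(\varepsilon,p)\,e^{\langle\varphi\rangle_J}$ for every $\varphi\in\mathrm{BMO}((0,1))$ with $\|\varphi\|_{\mathrm{BMO}^p((0,1))}\le\varepsilon$ and every subinterval $J\subset(0,1)$. The John--Nirenberg constant $\varepsilon_0(p)$ is the largest number such that $C(\varepsilon,p)<\infty$ for all $0\le\varepsilon<\varepsilon_0(p)$. *)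

theory Defs
  imports "HOL-Analysis.Analysis"
begin

text \<open>
  Throughout, functions on an interval \<open>Q\<close> are represented by total functions on the reals of
  which only the values on \<open>Q\<close> matter.  Subintervals may be open, closed or half-open; they are
  required to have positive finite length, so that averages over them make sense.
\<close>

definition subintervals :: "real set \<Rightarrow> real set set" where
  "subintervals Q = {J. J \<subseteq> Q \<and> is_interval J \<and> bounded J \<and> interior J \<noteq> {}}"

definition avg :: "real set \<Rightarrow> (real \<Rightarrow> real) \<Rightarrow> real" where
  "avg J f = (LINT t:J|lebesgue. f t) / measure lebesgue J"

text \<open>
  The average of a nonnegative function, as an element of \<open>[0, \<infinity>]\<close>.
\<close>

definition eavg :: "real set \<Rightarrow> (real \<Rightarrow> real) \<Rightarrow> ereal" where
  "eavg J f = (if f absolutely_integrable_on J then ereal (avg J f) else \<infinity>)"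

definition locally_integrable_on :: "(real \<Rightarrow> real) \<Rightarrow> real set \<Rightarrow> bool" where
  "locally_integrable_on f Q \<longleftrightarrow> (\<forall>K. compact K \<and> K \<subseteq> Q \<longrightarrow> f absolutely_integrable_on K)"

text \<open>
  A locally integrable function on \<open>Q\<close> need not be integrable over a subinterval \<open>J\<close> touching an
  endpoint of an open \<open>Q\<close>.  If the average over \<open>J\<close> or the \<open>p\<close>-th mean of the oscillation does
  not exist, the oscillation is infinite (rather than the default value of the integral).
  In the same way, \<open>ainf_ratio\<close> below is infinite if one of its two averages does not exist.
\<close>

definition osc :: "real \<Rightarrow> (real \<Rightarrow> real) \<Rightarrow> real set \<Rightarrow> ereal" where
  "osc p f J =
     (if f absolutely_integrable_on J \<and>
         (\<lambda>t. \<bar>f t - avg J f\<bar> powr p) absolutely_integrable_on J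
      then ereal (avg J (\<lambda>t. \<bar>f t - avg J f\<bar> powr p) powr (1 / p))
      else \<infinity>)"

definition bmo_norm :: "real \<Rightarrow> real set \<Rightarrow> (real \<Rightarrow> real) \<Rightarrow> ereal" where
  "bmo_norm p Q f = (SUP J\<in>subintervals Q. osc p f J)"

text \<open>
  The set of functions of finite \<open>bmo_norm p\<close> does not depend on \<open>p > 0\<close>; it is defined here
  with \<open>p = 1\<close>.
\<close>

definition BMO :: "real set \<Rightarrow> (real \<Rightarrow> real) set" where
  "BMO Q = {f. locally_integrable_on f Q \<and> bmo_norm 1 Q f < \<infinity>}"

definition ainf_ratio :: "(real \<Rightarrow> real) \<Rightarrow> real set \<Rightarrow> ereal" where
  "ainf_ratio w J =
     (if w absolutely_integrable_on J \<and> (\<lambda>t. ln (w t)) absolutely_integrable_on J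
      then ereal (avg J w * exp (- avg J (\<lambda>t. ln (w t))))
      else \<infinity>)"

definition ainf_char :: "real set \<Rightarrow> (real \<Rightarrow> real) \<Rightarrow> ereal" where
  "ainf_char Q w = (SUP J\<in>subintervals Q. ainf_ratio w J)"

definition A_infty :: "real set \<Rightarrow> (real \<Rightarrow> real) set" where
  "A_infty Q = {w. (AE t in lebesgue. t \<in> Q \<longrightarrow> w t > 0) \<and>
                   locally_integrable_on w Q \<and> locally_integrable_on (\<lambda>t. ln (w t)) Q \<and>
                   ainf_char Q w < \<infinity>}"

definition eps_of :: "real set \<Rightarrow> (real \<Rightarrow> real) \<Rightarrow> ereal" where
  "eps_of Q f = Sup {ereal \<epsilon> | \<epsilon>. \<epsilon> > 0 \<and> (\<lambda>t. exp (\<epsilon> * f t)) \<in> A_infty Q}"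

definition jn_bound :: "real \<Rightarrow> real \<Rightarrow> ereal \<Rightarrow> bool" where
  "jn_bound \<epsilon> p C \<longleftrightarrow>
     (\<forall>f\<in>BMO {0<..<1}. bmo_norm p {0<..<1} f \<le> ereal \<epsilon> \<longrightarrow>
        (\<forall>J\<in>subintervals {0<..<1}. eavg J (\<lambda>t. exp (f t)) \<le> C * ereal (exp (avg J f))))"

text \<open>
  The infimum and the supremum in the next two definitions are attained; see
  \<open>jn_bound_jn_const\<close> and \<open>jn_const_finite_below_jn_eps0\<close>.
\<close>

definition jn_const :: "real \<Rightarrow> real \<Rightarrow> ereal" where
  "jn_const \<epsilon> p = Inf {C. 1 \<le> C \<and> jn_bound \<epsilon> p C}"

definition jn_eps0 :: "real \<Rightarrow> ereal" where
  "jn_eps0 p = Sup {e. 0 \<le> e \<and> (\<forall>\<epsilon>::real. 0 \<le> \<epsilon> \<and> ereal \<epsilon> < e \<longrightarrow> jn_const \<epsilon> p < \<infinity>)}"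

lemma jn_bound_jn_const: "1 \<le> jn_const \<epsilon> p \<and> jn_bound \<epsilon> p (jn_const \<epsilon> p)"
proof
  show "1 \<le> jn_const \<epsilon> p"
    unfolding jn_const_def by (rule Inf_greatest) simp
  have "eavg J (\<lambda>t. exp (f t)) \<le> jn_const \<epsilon> p * ereal (exp (avg J f))"
    if f: "f \<in> BMO {0<..<1}" "bmo_norm p {0<..<1} f \<le> ereal \<epsilon>" and J: "J \<in> subintervals {0<..<1}"
    for f J
  proof -
    have "eavg J (\<lambda>t. exp (f t)) / ereal (exp (avg J f)) \<le> jn_const \<epsilon> p"
      unfolding jn_const_def
    proof (rule Inf_greatest)
      fix C assume "C \<in> {C. 1 \<le> C \<and> jn_bound \<epsilon> p C}"
      then have "eavg J (\<lambda>t. exp (f t)) \<le> C * ereal (exp (avg J f))"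
        using f J unfolding jn_bound_def by blast
      then show "eavg J (\<lambda>t. exp (f t)) / ereal (exp (avg J f)) \<le> C"
        by (simp add: ereal_divide_le_pos mult.commute)
    qed
    then show ?thesis
      by (simp add: ereal_divide_le_pos mult.commute)
  qed
  then show "jn_bound \<epsilon> p (jn_const \<epsilon> p)"
    unfolding jn_bound_def by blast
qed

lemma jn_const_finite_below_jn_eps0:
  assumes "0 \<le> \<epsilon>" "ereal \<epsilon> < jn_eps0 p"
  shows "jn_const \<epsilon> p < \<infinity>"
  using assms unfolding jn_eps0_def less_Sup_iff by blast

definition phi0 :: "real \<Rightarrow> real" where
  "phi0 t = ln (1 / t)"

definition omega :: "real \<Rightarrow> real" where
  "omega p =
     (p / exp 1 * (Gamma p - (LINT t:{0<..<1}|lebesgue. t powr (p - 1) * exp t)) + 1) powr (1 / p)"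

end

theory Submission
  imports Defs
begin

text \<open>
  Let \<open>J\<close> have endpoints \<open>a < b\<close> in \<open>[0, 1]\<close>.  Rescaling \<open>J\<close> to the unit interval, compare
  \<open>u s = phi0 s - 1\<close> with \<open>v s = phi0 (a + (b - a) * s) - avg J phi0\<close>.  Both have mean zero, \<open>v\<close> is
  decreasing, and so is \<open>u - v\<close>, because \<open>u s - v s\<close> is a constant plus \<open>ln (b - a + a / s)\<close>.
  Hence \<open>v\<close> is dominated by \<open>u\<close> in the convex order: for every convex \<open>h \<ge> 0\<close> the average of
  \<open>h (phi0 - avg J phi0)\<close> over \<open>J\<close> is at most that over \<open>(0, 1)\<close>.  With \<open>h x = \<bar>x\<bar> powr p\<close> this
  computes the norm, with \<open>h x = exp (c * x)\<close> it gives membership in \<open>A_infty\<close>, and the averages over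
  \<open>(0, 1)\<close> become Gamma integrals under \<open>s = exp (- x)\<close>.  Multiples of \<open>phi0\<close> are then the
  extremal examples for the bounds on the constants.
\<close>

lemma convex_on_abs_powr:
  fixes p :: real
  assumes "p \<ge> 1"
  shows "convex_on UNIV (\<lambda>x::real. \<bar>x\<bar> powr p)"
proof (rule convex_onI)
  fix t x y :: real
  assume t: "0 < t" "t < 1"
  have scale: "(r * z) powr p \<le> r * z powr p" if "0 < r" "r < 1" "0 \<le> z" for r z :: real
  proof -
    have "r powr p \<le> r powr 1"
      using that assms by (intro powr_mono') auto
    then show ?thesis
      using that by (simp add: powr_mult mult_right_mono)
  qed
  have "\<bar>(1 - t) *\<^sub>R x + t *\<^sub>R y\<bar> \<le> (1 - t) * \<bar>x\<bar> + t * \<bar>y\<bar>"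
    using t abs_triangle_ineq[of "(1 - t) * x" "t * y"] by (simp add: abs_mult)
  then have "\<bar>(1 - t) *\<^sub>R x + t *\<^sub>R y\<bar> powr p \<le> ((1 - t) * \<bar>x\<bar> + t * \<bar>y\<bar>) powr p"
    using assms by (intro powr_mono2) auto
  also have "\<dots> \<le> (1 - t) * \<bar>x\<bar> powr p + t * \<bar>y\<bar> powr p"
  proof (cases "x = 0 \<or> y = 0")
    case True
    then show ?thesis
      using t scale[of t "\<bar>y\<bar>"] scale[of "1 - t" "\<bar>x\<bar>"] by auto
  next
    case False
    then show ?thesis
      using convex_onD[OF powr_convex[OF assms], of t "\<bar>x\<bar>" "\<bar>y\<bar>"] t by simp
  qed
  finally show "\<bar>(1 - t) *\<^sub>R x + t *\<^sub>R y\<bar> powr p \<le> (1 - t) * \<bar>x\<bar> powr p + t * \<bar>y\<bar> powr p" .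
qed simp

lemma convex_on_exp_cmul: "convex_on UNIV (\<lambda>x::real. exp (c * x))"
  by (intro f''_ge0_imp_convex derivative_eq_intros | simp add: mult.assoc)+

lemma convex_subgradient:
  fixes h :: "real \<Rightarrow> real"
  assumes "convex_on UNIV h"
  obtains c where "\<And>y. h x + c * (y - x) \<le> h y"
  using convex_le_Inf_differential[OF assms, of x] by auto

lemma convex_diff_ge:
  fixes h :: "real \<Rightarrow> real"
  assumes h: "convex_on UNIV h" and c: "\<And>y. h z + c * (y - z) \<le> h y"
    and "z \<le> v \<and> v \<le> u \<or> u \<le> v \<and> v \<le> z"
  shows "c * (u - v) \<le> h u - h v"
proof (cases "v = z")
  case True
  then show ?thesis using c[of u] by simp
next
  case False
  obtain d where d: "\<And>y. h v + d * (y - v) \<le> h y"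
    using convex_subgradient[OF h] by metis
  have "(d - c) * (v - z) \<ge> 0"
    using c[of v] d[of z] by (simp add: algebra_simps)
  then have "(d - c) * (u - v) \<ge> 0"
    using False assms(3) by (auto simp: zero_le_mult_iff)
  then show ?thesis
    using d[of u] by (simp add: algebra_simps)
qed

lemma integral_pos_if_continuous_pos:
  fixes g :: "real \<Rightarrow> real"
  assumes g: "g integrable_on {0<..<1}" and cont: "continuous_on {0<..<1} g"
    and pos: "\<And>s. s \<in> {0<..<1} \<Longrightarrow> 0 < g s"
  shows "0 < integral {0<..<1} g"
proof -
  have cont': "continuous_on {1/4..3/4} g"
    using cont by (rule continuous_on_subset) auto
  have pos': "0 < g s" if "s \<in> {1/4..3/4}" for s
    using that by (intro pos) auto
  have "integral {1/4..3/4} g = 0 \<longleftrightarrow> (\<forall>s\<in>{1/4..3/4}. g s = 0)"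
    using pos' by (intro integral_eq_0_iff cont') (auto intro: less_imp_le)
  then have "integral {1/4..3/4} g \<noteq> 0"
    using pos'[of "1/2"] by auto
  moreover have "0 \<le> integral {1/4..3/4} g"
    using pos' by (intro integral_nonneg integrable_continuous_real cont') (auto intro: less_imp_le)
  moreover have "integral {1/4..3/4} g \<le> integral {0<..<1} g"
    using pos by (intro integral_subset_le integrable_continuous_real cont' g) (auto intro: less_imp_le)
  ultimately show ?thesis by linarith
qed

lemma ex_zero_if_integral_zero:
  fixes g :: "real \<Rightarrow> real"
  assumes g: "g integrable_on {0<..<1}" and cont: "continuous_on {0<..<1} g"
    and zero: "integral {0<..<1} g = 0"
  shows "\<exists>s\<in>{0<..<1}. g s = 0"
proof -
  have "\<exists>s\<in>{0<..<1}. g s \<le> 0"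
    using integral_pos_if_continuous_pos[OF g cont] zero not_le by fastforce
  moreover have "\<exists>s\<in>{0<..<1}. 0 \<le> g s"
  proof (rule ccontr)
    assume "\<not> ?thesis"
    then have "0 < integral {0<..<1} (\<lambda>s. - g s)"
      by (intro integral_pos_if_continuous_pos integrable_neg g continuous_on_minus cont) (simp add: not_le)
    then show False using zero by simp
  qed
  moreover have "connected (g ` {0<..<1})"
    using cont by (rule connected_continuous_image) simp
  ultimately have "0 \<in> g ` {0<..<1}"
    unfolding connected_iff_interval by (meson imageI)
  then show ?thesis by auto
qed

lemma convex_order_of_antimono:
  fixes u v h :: "real \<Rightarrow> real"
  assumes h: "convex_on UNIV h" "\<And>x. 0 \<le> h x"
    and u: "u absolutely_integrable_on {0<..<1}" "continuous_on {0<..<1} u"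
    and v: "v absolutely_integrable_on {0<..<1}" "continuous_on {0<..<1} v"
    and eq: "integral {0<..<1} u = integral {0<..<1} v"
    and mono: "antimono_on {0<..<1} v" "antimono_on {0<..<1} (\<lambda>s. u s - v s)"
    and hu: "(\<lambda>s. h (u s)) absolutely_integrable_on {0<..<1}"
  shows "(\<lambda>s. h (v s)) absolutely_integrable_on {0<..<1}"
    and "integral {0<..<1} (\<lambda>s. h (v s)) \<le> integral {0<..<1} (\<lambda>s. h (u s))"
  \<comment> \<open>Let \<open>u\<close> and \<open>v\<close> cross at \<open>s0\<close>, and let \<open>c\<close> be a subgradient of \<open>h\<close> at \<open>v s0\<close>.  Then
    \<open>h \<circ> u - h \<circ> v \<ge> c * (u - v)\<close> pointwise, and the right-hand side has integral zero.\<close>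
proof -
  have intu: "u integrable_on {0<..<1}" and intv: "v integrable_on {0<..<1}"
    and inthu: "(\<lambda>s. h (u s)) integrable_on {0<..<1}"
    using u(1) v(1) hu by (auto simp: set_lebesgue_integral_eq_integral)
  have "\<exists>s\<in>{0<..<1}. u s - v s = 0"
    using eq intu intv
    by (intro ex_zero_if_integral_zero integrable_diff continuous_intros u v) (simp_all add: integral_diff)
  then obtain s0 where s0: "s0 \<in> {0<..<1}" "u s0 = v s0"
    by auto
  obtain c where c: "\<And>y. h (v s0) + c * (y - v s0) \<le> h y"
    using convex_subgradient[OF h(1)] by metis
  have le: "h (v s) \<le> h (u s) - c * (u s - v s)" if s: "s \<in> {0<..<1}" for s
  proof -
    have "v s0 \<le> v s \<and> v s \<le> u s \<or> u s \<le> v s \<and> v s \<le> v s0"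
      using monotone_onD[OF mono(1), of s s0] monotone_onD[OF mono(1), of s0 s]
        monotone_onD[OF mono(2), of s s0] monotone_onD[OF mono(2), of s0 s] s s0
      by (cases "s \<le> s0") auto
    from convex_diff_ge[OF h(1) c this] show ?thesis by simp
  qed
  have int: "(\<lambda>s. h (u s) - c * (u s - v s)) integrable_on {0<..<1}"
    using intu intv inthu by (intro integrable_diff integrable_on_mult_right) auto
  have "continuous_on {0<..<1} (\<lambda>s. h (v s))"
    using convex_on_continuous[OF open_UNIV h(1)] v(2)
    by (rule continuous_on_compose2) auto
  then have "(\<lambda>s. h (v s)) \<in> borel_measurable (lebesgue_on {0<..<1})"
    by (rule continuous_imp_measurable_on_sets_lebesgue) simp
  then show hv: "(\<lambda>s. h (v s)) absolutely_integrable_on {0<..<1}"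
    using int le h(2) by (intro measurable_bounded_by_integrable_imp_absolutely_integrable[where g = "\<lambda>s. h (u s) - c * (u s - v s)"]) auto
  have "integral {0<..<1} (\<lambda>s. h (v s)) \<le> integral {0<..<1} (\<lambda>s. h (u s) - c * (u s - v s))"
    using hv int le by (intro integral_le) (auto simp: set_lebesgue_integral_eq_integral)
  also have "\<dots> = integral {0<..<1} (\<lambda>s. h (u s))"
    using intu intv inthu eq
    by (simp add: integral_diff integrable_diff integrable_on_mult_right)
  finally show "integral {0<..<1} (\<lambda>s. h (v s)) \<le> integral {0<..<1} (\<lambda>s. h (u s))" .
qed

lemma subintervals_obtain_endpoints:
  assumes "J \<in> subintervals {0<..<1}"
  obtains a b where "0 \<le> a" "a < b" "b \<le> 1" "{a<..<b} \<subseteq> J" "J \<subseteq> {a..b}"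
proof -
  have J: "J \<subseteq> {0<..<1}" "is_interval J" "interior J \<noteq> {}"
    using assms by (auto simp: subintervals_def)
  then have ne: "J \<noteq> {}" by auto
  have bdd: "bdd_below J" "bdd_above J"
    using bounded_subset[OF _ J(1)] by (auto intro: bounded_imp_bdd_below bounded_imp_bdd_above)
  have sub: "{Inf J<..<Sup J} \<subseteq> J"
  proof
    fix x assume "x \<in> {Inf J<..<Sup J}"
    then obtain y z where "y \<in> J" "z \<in> J" "y < x" "x < z"
      using ne bdd cInf_lessD less_cSupD by (metis greaterThanLessThan_iff)
    then show "x \<in> J"
      using J(2) unfolding is_interval_1 by (meson less_imp_le)
  qed
  have sup: "J \<subseteq> {Inf J..Sup J}"
    using bdd by (auto intro: cInf_lower cSup_upper)
  have "Inf J < Sup J"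
  proof (rule ccontr)
    assume "\<not> ?thesis"
    then have "J \<subseteq> {Inf J}" using sup by fastforce
    then have "interior J \<subseteq> interior {Inf J}" by (rule interior_mono)
    then show False using J(3) by simp
  qed
  moreover have "0 \<le> Inf J" "Sup J \<le> 1"
    using J(1) by (auto intro!: cInf_greatest[OF ne] cSup_least[OF ne] dest!: subsetD)
  ultimately show ?thesis using that sub sup by blast
qed

context
  fixes a b :: real and J :: "real set"
  assumes ab: "a < b" and J: "{a<..<b} \<subseteq> J" "J \<subseteq> {a..b}"
begin

lemma affine_image_unit_interval: "(\<lambda>s. a + (b - a) * s) ` {0<..<1} = {a<..<b}"
proof
  show "{a<..<b} \<subseteq> (\<lambda>s. a + (b - a) * s) ` {0<..<1}"
  proof
    fix x assume "x \<in> {a<..<b}"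
    then have "x = a + (b - a) * ((x - a) / (b - a))" "(x - a) / (b - a) \<in> {0<..<1}"
      using ab by (auto simp: field_simps)
    then show "x \<in> (\<lambda>s. a + (b - a) * s) ` {0<..<1}" by blast
  qed
  show "(\<lambda>s. a + (b - a) * s) ` {0<..<1} \<subseteq> {a<..<b}"
  proof (clarsimp, intro conjI)
    fix s :: real assume "0 < s" "s < 1"
    then show "0 < (b - a) * s" using ab by simp
    have "(b - a) * s < (b - a) * 1" using ab \<open>s < 1\<close> by (intro mult_strict_left_mono) auto
    then show "a + (b - a) * s < b" by simp
  qed
qed

lemma negligible_diff_open_interval: "negligible (J - {a<..<b})" "negligible ({a<..<b} - J)"
proof -
  have "J - {a<..<b} \<subseteq> {a, b}" using J by auto
  then show "negligible (J - {a<..<b})"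
    by (meson finite.emptyI finite.insertI negligible_finite negligible_subset)
  show "negligible ({a<..<b} - J)" using J by (simp add: Diff_eq_empty_iff[THEN iffD2])
qed

lemma absolutely_integrable_on_interval_iff:
  fixes f :: "real \<Rightarrow> real"
  shows "f absolutely_integrable_on J \<longleftrightarrow> (\<lambda>s. f (a + (b - a) * s)) absolutely_integrable_on {0<..<1}"
proof -
  have "f absolutely_integrable_on J \<longleftrightarrow> f absolutely_integrable_on {a<..<b}"
    by (rule absolutely_integrable_spike_set_eq; rule negligible_subset, rule negligible_diff_open_interval) auto
  also have "\<dots> \<longleftrightarrow> (\<lambda>s. \<bar>b - a\<bar> * f (a + (b - a) * s)) absolutely_integrable_on {0<..<1}"
    unfolding affine_image_unit_interval[symmetric] using ab
    by (intro absolutely_integrable_change_of_variables_1')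
       (auto intro!: derivative_eq_intros inj_onI)
  also have "\<dots> \<longleftrightarrow> (\<lambda>s. f (a + (b - a) * s)) absolutely_integrable_on {0<..<1}"
    using ab by (simp add: set_integrable_mult_right_iff)
  finally show ?thesis .
qed

lemma avg_eq_integral_unit_interval:
  assumes f: "f absolutely_integrable_on J"
  shows "avg J f = integral {0<..<1} (\<lambda>s. f (a + (b - a) * s))"
proof -
  have "(\<lambda>s. \<bar>b - a\<bar> * f (a + (b - a) * s)) absolutely_integrable_on {0<..<1} \<and>
      integral {0<..<1} (\<lambda>s. \<bar>b - a\<bar> * f (a + (b - a) * s)) = (b - a) * integral {0<..<1} (\<lambda>s. f (a + (b - a) * s))"
    using f ab unfolding absolutely_integrable_on_interval_iff by (auto intro: set_integrable_mult_right)
  then have "integral {a<..<b} f = (b - a) * integral {0<..<1} (\<lambda>s. f (a + (b - a) * s))"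
    unfolding affine_image_unit_interval[symmetric] using ab
    by (subst (asm) has_absolute_integral_change_of_variables_1')
       (auto intro!: derivative_eq_intros inj_onI)
  moreover have "integral J f = integral {a<..<b} f"
    by (rule integral_spike_set; rule negligible_subset, rule negligible_diff_open_interval) auto
  moreover have "measure lebesgue J = measure lebesgue {a<..<b}"
    by (rule measure_negligible_symdiff)
       (use negligible_diff_open_interval in \<open>auto intro: negligible_Un\<close>)
  ultimately show ?thesis
    using ab f by (simp add: avg_def set_lebesgue_integral_eq_integral)
qed

end

lemma phi0_eq: "phi0 t = - ln t"
  by (simp add: phi0_def ln_div)

lemma continuous_on_phi0: "continuous_on {0<..} phi0"
  unfolding phi0_eq[abs_def] by (auto intro!: continuous_intros)

lemma absolutely_integrable_phi0_iff:
  fixes F :: "real \<Rightarrow> real"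
  shows "((\<lambda>s. F (phi0 s)) absolutely_integrable_on {0<..<1} \<and> integral {0<..<1} (\<lambda>s. F (phi0 s)) = b) \<longleftrightarrow>
    ((\<lambda>x. exp (- x) * F x) absolutely_integrable_on {0<..} \<and> integral {0<..} (\<lambda>x. exp (- x) * F x) = b)"
proof -
  have "s \<in> (\<lambda>x. exp (- x)) ` {0<..}" if "s \<in> {0<..<1}" for s :: real
    using that by (intro image_eqI[of _ _ "- ln s"]) auto
  then have image: "(\<lambda>x::real. exp (- x)) ` {0<..} = {0<..<1}"
    by auto
  have "(\<lambda>x. \<bar>- exp (- x)\<bar> * F (phi0 (exp (- x)))) absolutely_integrable_on {0<..} \<and>
      integral {0<..} (\<lambda>x. \<bar>- exp (- x)\<bar> * F (phi0 (exp (- x)))) = b \<longleftrightarrow>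
    (\<lambda>s. F (phi0 s)) absolutely_integrable_on (\<lambda>x. exp (- x)) ` {0<..} \<and>
      integral ((\<lambda>x. exp (- x)) ` {0<..}) (\<lambda>s. F (phi0 s)) = b"
    by (rule has_absolute_integral_change_of_variables_1')
       (auto intro!: derivative_eq_intros inj_onI)
  then show ?thesis
    unfolding image by (simp add: phi0_eq)
qed

lemma absolutely_integrable_if_has_integral_nonneg:
  fixes f :: "real \<Rightarrow> real"
  assumes "(f has_integral I) S" "\<And>x. x \<in> S \<Longrightarrow> 0 \<le> f x"
  shows "f absolutely_integrable_on S \<and> integral S f = I"
  using assms by (auto intro!: nonnegative_absolutely_integrable_1 intro: integral_unique)

lemma has_integral_greaterThan_iff:
  fixes f :: "real \<Rightarrow> real"
  shows "(f has_integral I) {a<..} \<longleftrightarrow> (f has_integral I) {a..}"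
  by (rule has_integral_spike_set_eq; rule negligible_subset[of "{a}"]) auto

lemma exp_phi0_integral:
  assumes "c < 1"
  shows "(\<lambda>s. exp (c * phi0 s)) absolutely_integrable_on {0<..<1}"
    and "integral {0<..<1} (\<lambda>s. exp (c * phi0 s)) = 1 / (1 - c)"
proof -
  have "((\<lambda>x. exp (- (1 - c) * x)) has_integral exp (- (1 - c) * 0) / (1 - c)) {0..}"
    using assms by (intro has_integral_exp_minus_to_infinity) auto
  then have "((\<lambda>x. exp (- x) * exp (c * x)) has_integral 1 / (1 - c)) {0<..}"
    by (simp add: has_integral_greaterThan_iff exp_add[symmetric] algebra_simps)
  from absolutely_integrable_if_has_integral_nonneg[OF this]
  have "(\<lambda>s. exp (c * phi0 s)) absolutely_integrable_on {0<..<1} \<and>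
      integral {0<..<1} (\<lambda>s. exp (c * phi0 s)) = 1 / (1 - c)"
    by (subst absolutely_integrable_phi0_iff) simp
  then show "(\<lambda>s. exp (c * phi0 s)) absolutely_integrable_on {0<..<1}"
    and "integral {0<..<1} (\<lambda>s. exp (c * phi0 s)) = 1 / (1 - c)" by auto
qed

lemma not_integrable_exp_phi0:
  assumes "1 \<le> c"
  shows "\<not> (\<lambda>s. exp (c * phi0 s)) absolutely_integrable_on {0<..<1}"
proof
  assume "(\<lambda>s. exp (c * phi0 s)) absolutely_integrable_on {0<..<1}"
  then have int: "(\<lambda>s. exp (c * phi0 s)) integrable_on {0<..<1}"
    by (rule set_lebesgue_integral_eq_integral)
  define I where "I = integral {0<..<1} (\<lambda>s. exp (c * phi0 s))"
  have "0 \<le> I"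
    unfolding I_def using int by (intro integral_nonneg) auto
  define d where "d = 1 - 1 / (I + 1)"
  have d: "d < 1" "1 / (1 - d) = I + 1"
    using \<open>0 \<le> I\<close> by (auto simp: d_def)
  have "I + 1 = integral {0<..<1} (\<lambda>s. exp (d * phi0 s))"
    using exp_phi0_integral(2)[OF d(1)] d(2) by simp
  also have "\<dots> \<le> I"
    unfolding I_def
  proof (rule integral_le[OF _ int])
    show "(\<lambda>s. exp (d * phi0 s)) integrable_on {0<..<1}"
      using exp_phi0_integral(1)[OF d(1)] by (rule set_lebesgue_integral_eq_integral)
    fix s :: real assume "s \<in> {0<..<1}"
    then have "0 \<le> phi0 s" by (simp add: phi0_eq)
    then show "exp (d * phi0 s) \<le> exp (c * phi0 s)"
      using d(1) assms by (auto intro!: mult_right_mono)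
  qed
  finally show False by simp
qed

lemma phi0_integral:
  "phi0 absolutely_integrable_on {0<..<1}" "integral {0<..<1} phi0 = 1"
proof -
  have "((\<lambda>x::real. x powr (2 - 1) / exp x) has_integral Gamma 2) {0<..}"
    by (subst has_integral_greaterThan_iff, rule Gamma_integral_real) simp
  moreover have "Gamma (2::real) = 1"
    using Gamma_fact[of 1, where ?'a = real] by simp
  ultimately have "((\<lambda>x::real. exp (- x) * x) has_integral 1) {0<..}"
    by (subst has_integral_cong[where g = "\<lambda>x. x powr (2 - 1) / exp x"]) (auto simp: exp_minus field_simps)
  then have "(\<lambda>x::real. exp (- x) * x) absolutely_integrable_on {0<..} \<and> integral {0<..} (\<lambda>x::real. exp (- x) * x) = 1"
    by (rule absolutely_integrable_if_has_integral_nonneg) simp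
  then have "phi0 absolutely_integrable_on {0<..<1} \<and> integral {0<..<1} phi0 = 1"
    by (rule absolutely_integrable_phi0_iff[of "\<lambda>x. x", THEN iffD2])
  then show "phi0 absolutely_integrable_on {0<..<1}" "integral {0<..<1} phi0 = 1" by auto
qed

lemma absolutely_integrable_powr_exp:
  fixes q :: real
  assumes "0 \<le> q"
  shows "(\<lambda>t. t powr q * exp t) absolutely_integrable_on {0<..<1}"
proof (rule measurable_bounded_by_integrable_imp_absolutely_integrable[where g = "\<lambda>_. exp 1"])
  show "(\<lambda>t::real. t powr q * exp t) \<in> borel_measurable (lebesgue_on {0<..<1})"
    by (intro continuous_imp_measurable_on_sets_lebesgue continuous_intros) auto
  show "(\<lambda>_. exp 1 :: real) integrable_on {0<..<1::real}"
    by (rule integrable_on_const) simp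
  fix t :: real assume t: "t \<in> {0<..<1}"
  then have "t powr q \<le> 1" using assms by (simp add: powr_le1)
  then show "norm (t powr q * exp t) \<le> exp 1"
    using mult_mono[of "t powr q" 1 "exp t" "exp 1"] t by (simp add: abs_mult)
qed simp

lemma has_integral_powr_exp:
  fixes p :: real
  assumes "1 \<le> p"
  shows "((\<lambda>t. t powr p * exp t) has_integral
      exp 1 - p * integral {0<..<1} (\<lambda>t. t powr (p - 1) * exp t)) {0<..<1}"
proof -
  have "continuous_on {0..1} (\<lambda>t::real. t powr p * exp t)"
    using assms by (intro continuous_on_mult continuous_on_powr' continuous_intros) auto
  then have "((\<lambda>t. p * t powr (p - 1) * exp t + t powr p * exp t) has_integral
      1 powr p * exp 1 - 0 powr p * exp 0) {0..1}"
    using assms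
    by (intro fundamental_theorem_of_calculus_interior[where f = "\<lambda>t. t powr p * exp t"])
       (auto intro!: derivative_eq_intros simp: has_real_derivative_iff_has_vector_derivative[symmetric])
  then have 1: "((\<lambda>t. p * (t powr (p - 1) * exp t) + t powr p * exp t) has_integral exp 1) {0<..<1}"
    using assms by (simp add: mult.assoc has_integral_Icc_iff_Ioo)
  have "((\<lambda>t. t powr (p - 1) * exp t) has_integral
      integral {0<..<1} (\<lambda>t. t powr (p - 1) * exp t)) {0<..<1}"
    using assms
    by (intro integrable_integral set_lebesgue_integral_eq_integral absolutely_integrable_powr_exp) simp
  from has_integral_diff[OF 1 has_integral_mult_right[OF this, of p]] show ?thesis
    by simp
qed

lemma has_integral_abs_powr_exp:
  fixes p :: real
  assumes "1 \<le> p"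
  shows "((\<lambda>x. exp (- x) * \<bar>x - 1\<bar> powr p) has_integral
      p / exp 1 * (Gamma p - integral {0<..<1} (\<lambda>t. t powr (p - 1) * exp t)) + 1) {0<..}"
    (is "(?f has_integral _) _")
proof -
  let ?I = "integral {0<..<1} (\<lambda>t. t powr (p - 1) * exp t)"
  have "((\<lambda>t. t powr p * exp t) has_integral exp 1 - p * ?I) {0<..<1}"
    by (rule has_integral_powr_exp[OF assms])
  from has_integral_mult_right[OF this, of "exp (- 1)"]
  have "((\<lambda>t. \<bar>- 1\<bar> * ?f (1 - t)) has_integral exp (- 1) * (exp 1 - p * ?I)) {0<..<1}"
    by (rule has_integral_eq[rotated]) (simp add: exp_diff exp_minus field_simps)
  from absolutely_integrable_if_has_integral_nonneg[OF this]
  have "?f absolutely_integrable_on (\<lambda>t. 1 - t) ` {0<..<1} \<and>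
      integral ((\<lambda>t. 1 - t) ` {0<..<1}) ?f = exp (- 1) * (exp 1 - p * ?I)"
    by (subst has_absolute_integral_change_of_variables_1'[symmetric, where g' = "\<lambda>_. - 1"])
       (auto intro!: derivative_eq_intros inj_onI)
  moreover have "x \<in> (\<lambda>t. 1 - t) ` {0<..<1}" if "x \<in> {0<..<1}" for x :: real
    using that by (intro image_eqI[of _ _ "1 - x"]) auto
  then have "(\<lambda>t::real. 1 - t) ` {0<..<1} = {0<..<1}"
    by auto
  ultimately have 1: "(?f has_integral exp (- 1) * (exp 1 - p * ?I)) {0<..<1}"
    by (auto simp: has_integral_iff set_lebesgue_integral_eq_integral)
  have "((\<lambda>t. t powr (p + 1 - 1) / exp t) has_integral Gamma (p + 1)) {0<..}"
    using assms by (subst has_integral_greaterThan_iff, intro Gamma_integral_real) simp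
  from has_integral_mult_right[OF this, of "exp (- 1)"]
  have "((\<lambda>t. \<bar>1\<bar> * ?f (1 + t)) has_integral exp (- 1) * Gamma (p + 1)) {0<..}"
    by (rule has_integral_eq[rotated]) (simp add: exp_diff exp_minus field_simps)
  from absolutely_integrable_if_has_integral_nonneg[OF this]
  have "?f absolutely_integrable_on (\<lambda>t. 1 + t) ` {0<..} \<and>
      integral ((\<lambda>t. 1 + t) ` {0<..}) ?f = exp (- 1) * Gamma (p + 1)"
    by (subst has_absolute_integral_change_of_variables_1'[symmetric, where g' = "\<lambda>_. 1"])
       (auto intro!: derivative_eq_intros inj_onI)
  moreover have "x \<in> (\<lambda>t. 1 + t) ` {0<..}" if "x \<in> {1<..}" for x :: real
    using that by (intro image_eqI[of _ _ "x - 1"]) auto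
  then have "(\<lambda>t::real. 1 + t) ` {0<..} = {1<..}"
    by auto
  ultimately have 2: "(?f has_integral exp (- 1) * Gamma (p + 1)) {1<..}"
    by (auto simp: has_integral_iff set_lebesgue_integral_eq_integral)
  have "(?f has_integral exp (- 1) * (exp 1 - p * ?I) + exp (- 1) * Gamma (p + 1)) ({0<..<1} \<union> {1<..})"
    by (intro has_integral_Un 1 2) (auto intro!: negligible_subset[of "{}"])
  moreover have "Gamma (p + 1) = p * Gamma p"
    using assms by (intro Gamma_plus1) (auto elim: nonpos_Ints_cases)
  then have "exp (- 1) * (exp 1 - p * ?I) + exp (- 1) * Gamma (p + 1) = p / exp 1 * (Gamma p - ?I) + 1"
    by (simp add: exp_minus field_simps)
  moreover have "(?f has_integral I) ({0<..<1} \<union> {1<..}) \<longleftrightarrow> (?f has_integral I) {0<..}" for I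
    by (rule has_integral_spike_set_eq; rule negligible_subset[of "{1}"]) auto
  ultimately show ?thesis by simp
qed

lemma abs_powr_phi0_integral:
  fixes p :: real
  assumes "1 \<le> p"
  shows "(\<lambda>s. \<bar>phi0 s - 1\<bar> powr p) absolutely_integrable_on {0<..<1}"
    and "(integral {0<..<1} (\<lambda>s. \<bar>phi0 s - 1\<bar> powr p)) powr (1 / p) = omega p"
proof -
  let ?I = "integral {0<..<1} (\<lambda>t. t powr (p - 1) * exp t)"
  have *: "(\<lambda>s. \<bar>phi0 s - 1\<bar> powr p) absolutely_integrable_on {0<..<1} \<and>
      integral {0<..<1} (\<lambda>s. \<bar>phi0 s - 1\<bar> powr p) = p / exp 1 * (Gamma p - ?I) + 1"
    using absolutely_integrable_if_has_integral_nonneg[OF has_integral_abs_powr_exp[OF assms]]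
    by (subst absolutely_integrable_phi0_iff) simp
  then show "(\<lambda>s. \<bar>phi0 s - 1\<bar> powr p) absolutely_integrable_on {0<..<1}" by blast
  have "(LINT t:{0<..<1}|lebesgue. t powr (p - 1) * exp t) = ?I"
    using absolutely_integrable_powr_exp[of "p - 1"] assms by (simp add: set_lebesgue_integral_eq_integral)
  with * show "(integral {0<..<1} (\<lambda>s. \<bar>phi0 s - 1\<bar> powr p)) powr (1 / p) = omega p"
    by (simp add: omega_def)
qed

lemma const_absolutely_integrable_unit_interval:
  fixes c :: real
  shows "(\<lambda>_. c) absolutely_integrable_on {0<..<1::real}" "integral {0<..<1::real} (\<lambda>_. c) = c"
  using integral_open_interval_real[of 0 1 "\<lambda>_. c"] by (simp_all add: absolutely_integrable_on_const)

lemma phi0_oscillation_le: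
  fixes h :: "real \<Rightarrow> real"
  assumes J: "J \<in> subintervals {0<..<1}"
    and h: "convex_on UNIV h" "\<And>x. 0 \<le> h x"
    and int: "(\<lambda>s. h (phi0 s - 1)) absolutely_integrable_on {0<..<1}"
  shows "phi0 absolutely_integrable_on J"
    and "(\<lambda>t. h (phi0 t - avg J phi0)) absolutely_integrable_on J"
    and "avg J (\<lambda>t. h (phi0 t - avg J phi0)) \<le> integral {0<..<1} (\<lambda>s. h (phi0 s - 1))"
proof -
  obtain a b where ab: "0 \<le> a" "a < b" "b \<le> 1" "{a<..<b} \<subseteq> J" "J \<subseteq> {a..b}"
    using subintervals_obtain_endpoints[OF J] .
  note iff = absolutely_integrable_on_interval_iff[OF ab(2,4,5)]
  define w where "w s = phi0 (a + (b - a) * s)" for s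
  have arg: "0 < (b - a) * s" "(b - a) * s \<le> a + (b - a) * s" "a + (b - a) * s < 1" if "s \<in> {0<..<1}" for s
  proof -
    show "0 < (b - a) * s" "(b - a) * s \<le> a + (b - a) * s"
      using that ab by auto
    have "(b - a) * s < (b - a) * 1" using that ab by (intro mult_strict_left_mono) auto
    then have "(b - a) * s < b - a" by (simp only: mult_1_right)
    then show "a + (b - a) * s < 1" using ab by linarith
  qed
  have cont_phi0: "continuous_on {0<..<1} phi0"
    using continuous_on_phi0 by (rule continuous_on_subset) auto
  have cont_w: "continuous_on {0<..<1} w"
    unfolding w_def
  proof (rule continuous_on_compose2[OF continuous_on_phi0])
    show "continuous_on {0<..<1} (\<lambda>s. a + (b - a) * s)"
      by (intro continuous_intros)
    show "(\<lambda>s. a + (b - a) * s) ` {0<..<1} \<subseteq> {0<..}"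
      using less_le_trans[OF arg(1,2)] by blast
  qed
  have w: "w absolutely_integrable_on {0<..<1}"
  proof (rule measurable_bounded_by_integrable_imp_absolutely_integrable[where g = "\<lambda>s. phi0 s + phi0 (b - a)"])
    show "w \<in> borel_measurable (lebesgue_on {0<..<1})"
      by (intro continuous_imp_measurable_on_sets_lebesgue cont_w) auto
    show "(\<lambda>s. phi0 s + phi0 (b - a)) integrable_on {0<..<1}"
      using phi0_integral(1) const_absolutely_integrable_unit_interval(1)
      by (intro integrable_add set_lebesgue_integral_eq_integral)
    fix s :: real assume s: "s \<in> {0<..<1}"
    have "ln ((b - a) * s) \<le> ln (a + (b - a) * s)"
      using arg[OF s] by (intro ln_mono) auto
    moreover have "ln (a + (b - a) * s) \<le> 0"
      using arg[OF s] by (simp add: ln_le_zero_iff)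
    moreover have "ln ((b - a) * s) = ln (b - a) + ln s"
      using s ab by (simp add: ln_mult)
    ultimately show "norm (w s) \<le> phi0 s + phi0 (b - a)"
      by (simp add: w_def phi0_eq)
  qed simp
  then show phi0: "phi0 absolutely_integrable_on J"
    unfolding iff w_def .
  define m where "m = avg J phi0"
  have m: "m = integral {0<..<1} w"
    unfolding m_def w_def by (rule avg_eq_integral_unit_interval[OF ab(2,4,5) phi0])
  note const = const_absolutely_integrable_unit_interval
  have zero: "integral {0<..<1} (\<lambda>s. phi0 s - 1) = 0" "integral {0<..<1} (\<lambda>s. w s - m) = 0"
    using phi0_integral w const m by (simp_all add: integral_diff set_lebesgue_integral_eq_integral)
  have anti: "antimono_on {0<..<1} (\<lambda>s. w s - m)"
    using arg ab unfolding w_def phi0_eq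
    by (intro monotone_onI) (auto intro!: ln_mono mult_left_mono simp: add_nonneg_pos)
  have anti': "antimono_on {0<..<1} (\<lambda>s. (phi0 s - 1) - (w s - m))"
  proof (rule monotone_onI)
    fix s t :: real assume st: "s \<in> {0<..<1}" "t \<in> {0<..<1}" "s \<le> t"
    have "a * s \<le> a * t" using st ab by (intro mult_left_mono) auto
    then have "(a + (b - a) * t) * s \<le> (a + (b - a) * s) * t"
      by (simp add: algebra_simps)
    then have "ln ((a + (b - a) * t) * s) \<le> ln ((a + (b - a) * s) * t)"
      using st arg[OF st(1)] arg[OF st(2)] by (intro ln_mono) auto
    then have "ln (a + (b - a) * t) + ln s \<le> ln (a + (b - a) * s) + ln t"
      using st arg[OF st(1)] arg[OF st(2)] by (simp add: ln_mult)
    then show "(phi0 t - 1) - (w t - m) \<le> (phi0 s - 1) - (w s - m)"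
      by (simp add: w_def phi0_eq)
  qed
  have "(\<lambda>s. h (w s - m)) absolutely_integrable_on {0<..<1} \<and>
      integral {0<..<1} (\<lambda>s. h (w s - m)) \<le> integral {0<..<1} (\<lambda>s. h (phi0 s - 1))"
    by (intro conjI convex_order_of_antimono[where u = "\<lambda>s. phi0 s - 1" and v = "\<lambda>s. w s - m", OF h])
       (use zero anti anti' int in \<open>auto intro!: set_integral_diff phi0_integral w const continuous_intros cont_w cont_phi0\<close>)
  then show res: "(\<lambda>t. h (phi0 t - avg J phi0)) absolutely_integrable_on J"
    and "avg J (\<lambda>t. h (phi0 t - avg J phi0)) \<le> integral {0<..<1} (\<lambda>s. h (phi0 s - 1))"
    unfolding m_def[symmetric] iff
    by (simp_all add: w_def avg_eq_integral_unit_interval[OF ab(2,4,5)] iff)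
qed

lemma unit_interval_in_subintervals: "{0<..<1} \<in> subintervals {0<..<1}"
  by (simp add: subintervals_def interior_open is_interval_oo)

lemma avg_unit_interval:
  "f absolutely_integrable_on {0<..<1} \<Longrightarrow> avg {0<..<1} f = integral {0<..<1} f"
  by (simp add: avg_def set_lebesgue_integral_eq_integral)

lemma avg_cmul: "avg J (\<lambda>t. c * f t) = c * avg J f"
  by (simp add: avg_def)

lemma avg_nonneg: "(\<And>t. 0 \<le> f t) \<Longrightarrow> 0 \<le> avg J f"
  by (simp add: avg_def set_lebesgue_integral_def)

lemma osc_cmul:
  assumes "0 \<le> c" "0 < p" "f absolutely_integrable_on J"
    and "(\<lambda>t. \<bar>f t - avg J f\<bar> powr p) absolutely_integrable_on J"
  shows "osc p (\<lambda>t. c * f t) J = ereal (c * avg J (\<lambda>t. \<bar>f t - avg J f\<bar> powr p) powr (1 / p))"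
proof -
  have eq: "\<bar>c * f t - c * avg J f\<bar> powr p = c powr p * \<bar>f t - avg J f\<bar> powr p" for t
  proof -
    have "\<bar>c * f t - c * avg J f\<bar> = c * \<bar>f t - avg J f\<bar>"
      using assms(1) by (simp add: right_diff_distrib[symmetric] abs_mult)
    then show ?thesis using assms(1) by (simp add: powr_mult)
  qed
  have "0 \<le> avg J (\<lambda>t. \<bar>f t - avg J f\<bar> powr p)"
    by (rule avg_nonneg) simp
  then show ?thesis
    using assms by (simp add: osc_def avg_cmul eq powr_mult powr_powr)
qed

lemma osc_cmul_phi0_le:
  assumes "0 \<le> c" "1 \<le> p" "J \<in> subintervals {0<..<1}"
  shows "osc p (\<lambda>t. c * phi0 t) J \<le> ereal (c * omega p)"
proof -
  note osc = phi0_oscillation_le[OF assms(3) convex_on_abs_powr[OF assms(2)] _ abs_powr_phi0_integral(1)[OF assms(2)]]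
  have "osc p (\<lambda>t. c * phi0 t) J = ereal (c * avg J (\<lambda>t. \<bar>phi0 t - avg J phi0\<bar> powr p) powr (1 / p))"
    using assms osc by (intro osc_cmul) auto
  moreover have "avg J (\<lambda>t. \<bar>phi0 t - avg J phi0\<bar> powr p) powr (1 / p) \<le> omega p"
    unfolding abs_powr_phi0_integral(2)[OF assms(2), symmetric]
    using assms osc(3) by (intro powr_mono2 avg_nonneg) auto
  ultimately show ?thesis
    using assms(1) by (simp add: mult_left_mono)
qed

lemma bmo_norm_cmul_phi0_le:
  assumes "0 \<le> c" "1 \<le> p"
  shows "bmo_norm p {0<..<1} (\<lambda>t. c * phi0 t) \<le> ereal (c * omega p)"
  unfolding bmo_norm_def using osc_cmul_phi0_le[OF assms] by (rule SUP_least)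

lemma bmo_norm_phi0:
  assumes "1 \<le> p"
  shows "bmo_norm p {0<..<1} phi0 = ereal (omega p)"
proof (rule antisym)
  show "bmo_norm p {0<..<1} phi0 \<le> ereal (omega p)"
    using bmo_norm_cmul_phi0_le[of 1 p] assms by simp
  have "osc p phi0 {0<..<1} = ereal (omega p)"
    using assms phi0_integral abs_powr_phi0_integral[OF assms]
    by (simp add: osc_def avg_unit_interval)
  then show "ereal (omega p) \<le> bmo_norm p {0<..<1} phi0"
    unfolding bmo_norm_def using unit_interval_in_subintervals by (metis SUP_upper)
qed

lemma locally_integrable_on_if_continuous_on:
  assumes "continuous_on Q f"
  shows "locally_integrable_on f Q"
  unfolding locally_integrable_on_def
proof (intro allI impI)
  fix K assume K: "compact K \<and> K \<subseteq> Q"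
  then have cont: "continuous_on K f"
    using assms continuous_on_subset by blast
  obtain B where B: "\<And>x. x \<in> K \<Longrightarrow> norm (f x) \<le> B"
    using compact_imp_bounded[OF compact_continuous_image[OF cont]] K by (auto simp: bounded_iff)
  show "f absolutely_integrable_on K"
    using K cont B
    by (intro measurable_bounded_by_integrable_imp_absolutely_integrable[where g = "\<lambda>_. B"]
        continuous_imp_measurable_on_sets_lebesgue integrable_on_const)
       (auto intro: lmeasurable_compact compact_imp_closed fmeasurableD)
qed

lemma continuous_on_cmul_phi0: "continuous_on {0<..<1} (\<lambda>t. c * phi0 t)"
  by (intro continuous_intros continuous_on_subset[OF continuous_on_phi0]) auto

lemma cmul_phi0_in_BMO:
  assumes "0 \<le> c"
  shows "(\<lambda>t. c * phi0 t) \<in> BMO {0<..<1}"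
proof -
  have "bmo_norm 1 {0<..<1} (\<lambda>t. c * phi0 t) < \<infinity>"
    using bmo_norm_cmul_phi0_le[OF assms order_refl] by (rule le_less_trans) simp
  then show ?thesis
    unfolding BMO_def using locally_integrable_on_if_continuous_on[OF continuous_on_cmul_phi0] by blast
qed

lemma exp_phi0_in_A_infty:
  assumes "c < 1"
  shows "(\<lambda>t. exp (c * phi0 t)) \<in> A_infty {0<..<1}"
proof -
  define h where "h = (\<lambda>x::real. exp (c * x))"
  have conv: "convex_on UNIV h" and nonneg: "0 \<le> h x" for x
    by (simp_all add: h_def convex_on_exp_cmul)
  have split: "h (phi0 s - d) = exp (- c * d) * exp (c * phi0 s)" for s d
    by (simp add: h_def exp_add[symmetric] algebra_simps)
  have int: "(\<lambda>s. h (phi0 s - 1)) absolutely_integrable_on {0<..<1}"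
    unfolding split using exp_phi0_integral(1)[OF assms] by (rule set_integrable_mult_right)
  have "ainf_ratio (\<lambda>t. exp (c * phi0 t)) J \<le> ereal (integral {0<..<1} (\<lambda>s. h (phi0 s - 1)))"
    if J: "J \<in> subintervals {0<..<1}" for J
  proof -
    note osc = phi0_oscillation_le[OF J conv nonneg int]
    have "(\<lambda>t. exp (c * phi0 t)) absolutely_integrable_on J"
      using osc(2) unfolding split by simp
    then show ?thesis
      using osc(1,3) unfolding split avg_cmul by (simp add: ainf_ratio_def avg_cmul mult.commute)
  qed
  then have "ainf_char {0<..<1} (\<lambda>t. exp (c * phi0 t)) \<le> ereal (integral {0<..<1} (\<lambda>s. h (phi0 s - 1)))"
    unfolding ainf_char_def by (rule SUP_least)
  then have "ainf_char {0<..<1} (\<lambda>t. exp (c * phi0 t)) < \<infinity>"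
    by (rule le_less_trans) simp
  moreover have "locally_integrable_on (\<lambda>t. exp (c * phi0 t)) {0<..<1}"
    by (intro locally_integrable_on_if_continuous_on continuous_on_exp continuous_on_cmul_phi0)
  moreover have "locally_integrable_on (\<lambda>t. c * phi0 t) {0<..<1}"
    by (intro locally_integrable_on_if_continuous_on continuous_on_cmul_phi0)
  ultimately show ?thesis
    by (simp add: A_infty_def)
qed

lemma exp_phi0_notin_A_infty:
  assumes "1 \<le> c"
  shows "(\<lambda>t. exp (c * phi0 t)) \<notin> A_infty {0<..<1}"
proof -
  have "ainf_ratio (\<lambda>t. exp (c * phi0 t)) {0<..<1} = \<infinity>"
    using not_integrable_exp_phi0[OF assms] by (simp add: ainf_ratio_def)
  then have "ainf_char {0<..<1} (\<lambda>t. exp (c * phi0 t)) = \<infinity>"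
    unfolding ainf_char_def using unit_interval_in_subintervals
    by (metis SUP_upper ereal_infty_less_eq(1))
  then show ?thesis by (simp add: A_infty_def)
qed

lemma eps_of_phi0: "eps_of {0<..<1} phi0 = 1"
proof -
  have "eps_of {0<..<1} phi0 = Sup {ereal \<epsilon> | \<epsilon>. 0 < \<epsilon> \<and> \<epsilon> < 1}"
    unfolding eps_of_def using exp_phi0_in_A_infty exp_phi0_notin_A_infty by (metis not_le)
  also have "{ereal \<epsilon> | \<epsilon>. 0 < \<epsilon> \<and> \<epsilon> < 1} = {0<..<1}"
  proof
    show "{0<..<1} \<subseteq> {ereal \<epsilon> | \<epsilon>. 0 < \<epsilon> \<and> \<epsilon> < 1}"
    proof
      fix x :: ereal assume "x \<in> {0<..<1}"
      then show "x \<in> {ereal \<epsilon> | \<epsilon>. 0 < \<epsilon> \<and> \<epsilon> < 1}" by (cases x) auto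
    qed
  qed auto
  finally show ?thesis by simp
qed

lemma eps_of_uminus_phi0: "eps_of {0<..<1} (\<lambda>t. - phi0 t) = \<infinity>"
proof (rule ereal_top)
  fix B :: real
  have "(\<lambda>t. exp ((\<bar>B\<bar> + 1) * - phi0 t)) \<in> A_infty {0<..<1}"
    unfolding mult_minus_right mult_minus_left[symmetric] by (rule exp_phi0_in_A_infty) simp
  then have "ereal (\<bar>B\<bar> + 1) \<le> eps_of {0<..<1} (\<lambda>t. - phi0 t)"
    unfolding eps_of_def by (intro Sup_upper) (auto intro!: exI[of _ "\<bar>B\<bar> + 1"])
  then show "ereal B \<le> eps_of {0<..<1} (\<lambda>t. - phi0 t)"
    by (rule order_trans[rotated]) simp
qed

lemma jn_bound_cmul_phi0:
  assumes "0 \<le> c" "1 \<le> p" "jn_bound (c * omega p) p C"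
  shows "eavg {0<..<1} (\<lambda>t. exp (c * phi0 t)) \<le> C * ereal (exp c)"
proof -
  have "avg {0<..<1} (\<lambda>t. c * phi0 t) = c"
    using phi0_integral by (simp add: avg_cmul avg_unit_interval)
  then show ?thesis
    using assms(3) cmul_phi0_in_BMO[OF assms(1)] bmo_norm_cmul_phi0_le[OF assms(1,2)]
      unit_interval_in_subintervals
    unfolding jn_bound_def by metis
qed

lemma jn_const_ge:
  assumes "1 \<le> p" "0 \<le> c" "c < 1"
  shows "ereal (exp (- c) / (1 - c)) \<le> jn_const (c * omega p) p"
  unfolding jn_const_def
proof (rule Inf_greatest, clarify)
  fix C assume C: "jn_bound (c * omega p) p C"
  have "ereal (1 / (1 - c)) \<le> C * ereal (exp c)"
    using jn_bound_cmul_phi0[OF assms(2,1) C] exp_phi0_integral[OF assms(3)]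
    by (simp add: eavg_def avg_unit_interval)
  then show "ereal (exp (- c) / (1 - c)) \<le> C"
    using assms(3) by (cases C) (auto simp: exp_minus field_simps)
qed

lemma jn_eps0_le:
  assumes "1 \<le> p"
  shows "jn_eps0 p \<le> ereal (omega p)"
  unfolding jn_eps0_def
proof (rule Sup_least, clarify, rule ccontr)
  fix e assume e: "\<forall>\<epsilon>. 0 \<le> \<epsilon> \<and> ereal \<epsilon> < e \<longrightarrow> jn_const \<epsilon> p < \<infinity>" "\<not> e \<le> ereal (omega p)"
  have "0 \<le> omega p" by (simp add: omega_def)
  with e have "jn_const (omega p) p < \<infinity>" by simp
  moreover have "eavg {0<..<1} (\<lambda>t. exp (phi0 t)) = \<infinity>"
    using not_integrable_exp_phi0[of 1] by (simp add: eavg_def)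
  then have "\<infinity> \<le> jn_const (omega p) p * ereal (exp 1)"
    using jn_bound_cmul_phi0[of 1 p] jn_bound_jn_const[of "omega p" p] assms by simp
  ultimately show False
    by (cases "jn_const (omega p) p") auto
qed

theorem lemma3p2:
  "eps_of {0<..<1} phi0 = 1 \<and>
   eps_of {0<..<1} (\<lambda>t. - phi0 t) = \<infinity> \<and>
   (\<forall>p::real. p \<ge> 1 \<longrightarrow>
      bmo_norm p {0<..<1} phi0 = ereal (omega p) \<and>
      jn_eps0 p \<le> ereal (omega p) \<and>
      (\<forall>\<epsilon>::real. 0 \<le> \<epsilon> \<and> \<epsilon> < omega p \<longrightarrow>
         jn_const \<epsilon> p \<ge> ereal (exp (- \<epsilon> / omega p) / (1 - \<epsilon> / omega p))))"
proof (intro conjI allI impI eps_of_phi0 eps_of_uminus_phi0)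
  fix p :: real assume p: "p \<ge> 1"
  show "bmo_norm p {0<..<1} phi0 = ereal (omega p)" by (rule bmo_norm_phi0[OF p])
  show "jn_eps0 p \<le> ereal (omega p)" by (rule jn_eps0_le[OF p])
  fix \<epsilon> :: real assume \<epsilon>: "0 \<le> \<epsilon> \<and> \<epsilon> < omega p"
  then show "jn_const \<epsilon> p \<ge> ereal (exp (- \<epsilon> / omega p) / (1 - \<epsilon> / omega p))"
    using jn_const_ge[OF p, of "\<epsilon> / omega p"] by simp
qed

end
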